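(* The inequality $$|a_n\alpha-a_{n+1}|\ \ge\ |a_{n+1}\alpha-a_{n+2}|$$ holds for every non-negative integer $n$ if and only if $|\beta|\le 1$.
   Context: Let $a,b\in\mathbb{R}$ with $ab\neq 0$, and let $(c_0,c_1)\in\mathbb{R}^2$ with $(c_0,c_1)\neq(0,0)$. Let $(a_n)_{n\ge 0}$ be the real sequence defined by $a_0=c_0$, $a_1=c_1$ and $a_{n+2}-a\,a_{n+1}+b\,a_n=0$ for all $n\ge 0$. Put $\alpha_\pm=\frac{a\pm\sqrt{a^2-4b}}{2}$, the roots of $x^2-ax+b$, where $\sqrt{a^2-4b}=\sqrt{-1}\,\sqrt{4b-a^2}$ if $a^2-4b<0$. Let $\alpha,\beta$ denote these two roots labelled so that $\{\alpha,\beta\}=\{\alpha_+,\alpha_-\}$ and $|\alpha|\ge|\beta|$ (either labelling if $|\alpha_+|=|\alpha_-|$).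
   Formalization: The equivalence is stated for c_1 ≠ αc_0, and "|β| ≤ 1 implies the inequalities" for all (c_0,c_1); if c_1 = αc_0 both sides vanish for every n, so the converse fails when |β| > 1 (e.g. a=5, b=6, a_n=3^n, α=3, β=2). *)

theory Defs
  imports Complex_Main
begin

text \<open>
  The roots of \<open>x\<^sup>2 - a x + b\<close>. On real arguments the principal root \<^const>\<open>csqrt\<close> is
  \<open>sqrt x\<close> for \<open>x \<ge> 0\<close> and \<open>\<i> * sqrt (- x)\<close> for \<open>x < 0\<close>
  (\<open>csqrt_of_real_nonneg\<close>, \<open>csqrt_of_real_nonpos\<close>).
\<close>

definition root_plus :: "real \<Rightarrow> real \<Rightarrow> complex" where
  "root_plus a b = (of_real a + csqrt (of_real (a\<^sup>2 - 4 * b))) / 2"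

definition root_minus :: "real \<Rightarrow> real \<Rightarrow> complex" where
  "root_minus a b = (of_real a - csqrt (of_real (a\<^sup>2 - 4 * b))) / 2"

text \<open>
  Both labellings are admitted when the roots have equal modulus.
\<close>

definition labelled_roots :: "real \<Rightarrow> real \<Rightarrow> complex \<Rightarrow> complex \<Rightarrow> bool" where
  "labelled_roots a b \<alpha> \<beta> \<longleftrightarrow> {\<alpha>, \<beta>} = {root_plus a b, root_minus a b} \<and> cmod \<alpha> \<ge> cmod \<beta>"

text \<open>
  The implication from the inequalities to \<open>cmod \<beta> \<le> 1\<close> fails for the geometric sequences
  \<open>s n = c0 * \<alpha> ^ n\<close> (that is, \<open>c1 = \<alpha> * c0\<close>): every difference \<open>s n * \<alpha> - s (n + 1)\<close> is then
  \<open>0\<close>, whatever \<open>\<beta>\<close> is. For instance \<open>a = 5\<close>, \<open>b = 6\<close>, \<open>s n = 3 ^ n\<close> has \<open>\<alpha> = 3\<close> and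
  \<open>\<beta> = 2\<close>. The theorem therefore states the equivalence for \<open>c1 \<noteq> \<alpha> * c0\<close>, and the
  implication from \<open>cmod \<beta> \<le> 1\<close> without this restriction.
\<close>

end

theory Submission
  imports Defs
begin

text \<open>
  Write \<open>x\<^sup>2 - a x + b = (x - \<alpha>) (x - \<beta>)\<close>. The recurrence operator factors accordingly, as
  \<open>(S - \<beta>) (S - \<alpha>)\<close> with \<open>S\<close> the shift, so the defects \<open>\<alpha> s n - s (n + 1)\<close> of the sequence
  from being geometric with ratio \<open>\<alpha>\<close> form a geometric sequence with ratio \<open>\<beta>\<close>
  (lemma \<open>defect_geometric\<close>). Their moduli are therefore multiplied by \<open>cmod \<beta>\<close> at every step,
  and decrease if \<open>cmod \<beta> \<le> 1\<close>. Conversely, if the initial defect \<open>\<alpha> c0 - c1\<close> is nonzero, the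
  inequality between the first two moduli can be divided by it, which gives \<open>cmod \<beta> \<le> 1\<close>.
\<close>

lemma labelled_roots_vieta:
  assumes "labelled_roots a b \<alpha> \<beta>"
  shows "\<alpha> + \<beta> = of_real a" and "\<alpha> * \<beta> = of_real b"
proof -
  define d where "d = csqrt (of_real (a\<^sup>2 - 4 * b))"
  have d: "d\<^sup>2 = of_real a ^ 2 - 4 * of_real b"
    by (simp add: d_def)
  have sum: "root_plus a b + root_minus a b = of_real a"
    by (simp add: root_plus_def root_minus_def field_simps)
  have "root_plus a b * root_minus a b = (of_real a ^ 2 - d\<^sup>2) / 4"
    unfolding root_plus_def root_minus_def d_def[symmetric]
    by (simp add: power2_eq_square field_simps)
  then have prod: "root_plus a b * root_minus a b = of_real b"
    by (simp add: d)
  have "(\<alpha> = root_plus a b \<and> \<beta> = root_minus a b) \<or> (\<alpha> = root_minus a b \<and> \<beta> = root_plus a b)"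
    using assms by (auto simp: labelled_roots_def doubleton_eq_iff)
  then show "\<alpha> + \<beta> = of_real a" and "\<alpha> * \<beta> = of_real b"
    using sum prod by (auto simp: add.commute mult.commute)
qed

text \<open>
  Eliminating \<open>u (n + 2)\<close> leaves \<open>\<alpha> * \<beta> * u n - \<beta> * u (n + 1)\<close>, since the coefficient
  \<open>\<alpha> - (\<alpha> + \<beta>)\<close> of \<open>u (n + 1)\<close> is \<open>- \<beta>\<close>.
\<close>

lemma defect_geometric:
  fixes u :: "nat \<Rightarrow> 'a :: comm_ring_1"
  assumes "u (n + 2) - (\<alpha> + \<beta>) * u (n + 1) + \<alpha> * \<beta> * u n = 0"
  shows "u (n + 1) * \<alpha> - u (n + 2) = \<beta> * (u n * \<alpha> - u (n + 1))"
proof -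
  have "u (n + 2) = (\<alpha> + \<beta>) * u (n + 1) - \<alpha> * \<beta> * u n"
    using assms by (simp add: algebra_simps eq_neg_iff_add_eq_0)
  then show ?thesis
    by (simp add: algebra_simps)
qed

theorem theorem1p8:
  fixes a b c0 c1 :: real and s :: "nat \<Rightarrow> real" and \<alpha> \<beta> :: complex
  assumes "a * b \<noteq> 0"
    and "(c0, c1) \<noteq> (0, 0)"
    and "s 0 = c0" and "s 1 = c1"
    and "\<And>n. s (n + 2) - a * s (n + 1) + b * s n = 0"
    and "labelled_roots a b \<alpha> \<beta>"
  shows "(of_real c1 \<noteq> \<alpha> * of_real c0 \<longrightarrow>
           ((\<forall>n. cmod (of_real (s n) * \<alpha> - of_real (s (n + 1)))
                 \<ge> cmod (of_real (s (n + 1)) * \<alpha> - of_real (s (n + 2))))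
            \<longleftrightarrow> cmod \<beta> \<le> 1)) \<and>
         (cmod \<beta> \<le> 1 \<longrightarrow>
           (\<forall>n. cmod (of_real (s n) * \<alpha> - of_real (s (n + 1)))
                \<ge> cmod (of_real (s (n + 1)) * \<alpha> - of_real (s (n + 2)))))"
proof -
  define D where "D n = of_real (s n) * \<alpha> - of_real (s (n + 1))" for n
  have step: "D (Suc n) = \<beta> * D n" for n
  proof -
    have "complex_of_real (s (n + 2) - a * s (n + 1) + b * s n) = 0"
      using assms(5)[of n] by simp
    then have "complex_of_real (s (n + 2)) - (\<alpha> + \<beta>) * of_real (s (n + 1))
        + \<alpha> * \<beta> * of_real (s n) = 0"
      by (simp add: labelled_roots_vieta[OF assms(6)])
    from defect_geometric[of "\<lambda>n. complex_of_real (s n)", OF this] show ?thesis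
      by (simp add: D_def)
  qed
  have decreasing: "cmod (D (Suc n)) \<le> cmod (D n)" if "cmod \<beta> \<le> 1" for n
    using that by (simp add: step norm_mult mult_left_le_one_le)
  have bound: "cmod \<beta> \<le> 1"
    if "of_real c1 \<noteq> \<alpha> * of_real c0" and "cmod (D (Suc 0)) \<le> cmod (D 0)"
  proof -
    have "D 0 \<noteq> 0"
      using that(1) assms(3,4) by (simp add: D_def mult.commute)
    then show ?thesis
      using that(2) by (simp add: step norm_mult)
  qed
  have "(of_real c1 \<noteq> \<alpha> * of_real c0 \<longrightarrow>
          ((\<forall>n. cmod (D (Suc n)) \<le> cmod (D n)) \<longleftrightarrow> cmod \<beta> \<le> 1)) \<and>
        (cmod \<beta> \<le> 1 \<longrightarrow> (\<forall>n. cmod (D (Suc n)) \<le> cmod (D n)))"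
    using decreasing bound by blast
  then show ?thesis
    by (simp add: D_def)
qed

end
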